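(* Let $C$ be a conjugation on $L^2(\mathbb{T})$ such that $CM_{z^2}=M_{z^2}C$. Then there exist $\xi_1,\xi_2\in L^\infty(\mathbb{T})$ such that $C=M_{[\xi_1,\xi_2]}J^\star$, where $\xi_1,\xi_2$ satisfy, for a.e. $z\in\mathbb{T}$, $$|\xi_1|^2+|\xi_2|^2=2,\qquad |\xi_2^e+\xi_1^o|^2+|\xi_2^o+\xi_1^e|^2=2,$$ $$\xi_1^o(\bar z)=\xi_2^o(z),\qquad \xi_1^e(\bar z)=\xi_1^e(z),\qquad \xi_2^e(\bar z)=\xi_2^e(z).$$ Conversely, any conjugation $C$ on $L^2(\mathbb{T})$ of the form $C=M_{[\xi_1,\xi_2]}J^\star$ with $\xi_1,\xi_2\in L^\infty(\mathbb{T})$ commutes with $M_{z^2}$.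
   Context: $\mathbb{T}$ is the unit circle with normalized Lebesgue measure. A conjugation on a Hilbert space $\mathcal{H}$ is an antilinear map $C:\mathcal{H}\to\mathcal{H}$ with $C^2=I$ and $\langle Cf,Cg\rangle=\langle g,f\rangle$ for all $f,g$. For $\phi\in L^\infty(\mathbb{T})$, $M_\phi f=\phi f$ on $L^2(\mathbb{T})$. For $f\in L^2(\mathbb{T})$, $f^e(z)=\frac{f(z)+f(-z)}{2}$ and $f^o(z)=\frac{f(z)-f(-z)}{2}$ are the even and odd parts, so $f=f^e+f^o$. For $\phi_1,\phi_2\in L^\infty(\mathbb{T})$, $M_{[\phi_1,\phi_2]}$ is the bounded linear operator on $L^2(\mathbb{T})$ given by $M_{[\phi_1,\phi_2]}f=\phi_1f^e+\phi_2f^o$. The conjugation $J^\star$ on $L^2(\mathbb{T})$ is $(J^\star f)(z)=\overline{f(\bar z)}$. *)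

theory Defs
  imports "HOL-Analysis.Analysis"
begin

section \<open>Complex inner product spaces and conjugations\<close>

text \<open>
  The inner product is linear in its first argument.  Completeness is not part of the class:
  it does not enter into the definition of a conjugation.
\<close>

class complex_inner_space = ab_group_add +
  fixes scaleC :: "complex \<Rightarrow> 'a \<Rightarrow> 'a" (infixr "*\<^sub>C" 75)
    and cinner :: "'a \<Rightarrow> 'a \<Rightarrow> complex"
  assumes scaleC_add_right: "a *\<^sub>C (x + y) = a *\<^sub>C x + a *\<^sub>C y"
    and scaleC_add_left: "(a + b) *\<^sub>C x = a *\<^sub>C x + b *\<^sub>C x"
    and scaleC_scaleC: "a *\<^sub>C b *\<^sub>C x = (a * b) *\<^sub>C x"
    and scaleC_one: "1 *\<^sub>C x = x"
    and cinner_commute: "cinner x y = cnj (cinner y x)"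
    and cinner_add_left: "cinner (x + y) z = cinner x z + cinner y z"
    and cinner_scaleC_left: "cinner (a *\<^sub>C x) y = a * cinner x y"
    and cinner_ge_zero: "0 \<le> Re (cinner x x)"
    and cinner_eq_zero_iff: "cinner x x = 0 \<longleftrightarrow> x = 0"

definition antilinear :: "('a::complex_inner_space \<Rightarrow> 'a) \<Rightarrow> bool" where
  "antilinear C \<longleftrightarrow> (\<forall>a b f g. C (a *\<^sub>C f + b *\<^sub>C g) = cnj a *\<^sub>C C f + cnj b *\<^sub>C C g)"

definition conjugation :: "('a::complex_inner_space \<Rightarrow> 'a) \<Rightarrow> bool" where
  "conjugation C \<longleftrightarrow>
     antilinear C \<and> C \<circ> C = id \<and> (\<forall>f g. cinner (C f) (C g) = cinner g f)"


section \<open>The unit circle and its Lebesgue spaces\<close>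

definition circle :: "complex measure" where
  "circle = distr (uniform_measure lborel {0..<2 * pi}) (restrict_space borel (sphere 0 1)) cis"

text \<open>
  \<open>L2_fun\<close> and \<open>Linf_fun\<close> consist of functions; only their values on the circle matter.  Borel
  measurability loses nothing, since every Lebesgue measurable function agrees almost everywhere
  with a Borel function.
\<close>

definition L2_fun :: "(complex \<Rightarrow> complex) set" where
  "L2_fun = {f \<in> borel_measurable circle. integrable circle (\<lambda>z. (cmod (f z))\<^sup>2)}"

definition Linf_fun :: "(complex \<Rightarrow> complex) set" where
  "Linf_fun = {\<phi> \<in> borel_measurable circle. \<exists>K. AE z in circle. cmod (\<phi> z) \<le> K}"

definition L2_eq :: "(complex \<Rightarrow> complex) \<Rightarrow> (complex \<Rightarrow> complex) \<Rightarrow> bool" where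
  "L2_eq f g \<longleftrightarrow> f \<in> L2_fun \<and> g \<in> L2_fun \<and> (AE z in circle. f z = g z)"

lemma zero_in_L2_fun: "(\<lambda>_. 0) \<in> L2_fun"
  by (simp add: L2_fun_def)

quotient_type L2 = "complex \<Rightarrow> complex" / partial: L2_eq
proof (rule part_equivpI)
  show "\<exists>f. L2_eq f f"
    using zero_in_L2_fun by (auto simp: L2_eq_def)
  show "symp L2_eq"
    by (auto simp: symp_def L2_eq_def)
  show "transp L2_eq"
    by (auto simp: transp_def L2_eq_def)
qed

lemma L2_fun_add:
  assumes "f \<in> L2_fun" "g \<in> L2_fun"
  shows "(\<lambda>z. f z + g z) \<in> L2_fun"
proof -
  have m [measurable]: "f \<in> borel_measurable circle" "g \<in> borel_measurable circle"
    using assms by (auto simp: L2_fun_def)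
  have "integrable circle (\<lambda>z. 2 * (cmod (f z))\<^sup>2 + 2 * (cmod (g z))\<^sup>2)"
    using assms by (auto simp: L2_fun_def)
  moreover have "norm ((cmod (f z + g z))\<^sup>2) \<le> norm (2 * (cmod (f z))\<^sup>2 + 2 * (cmod (g z))\<^sup>2)" for z
  proof -
    have "(cmod (f z + g z))\<^sup>2 \<le> (cmod (f z) + cmod (g z))\<^sup>2"
      by (intro power_mono norm_triangle_ineq norm_ge_zero)
    also have "\<dots> \<le> 2 * (cmod (f z))\<^sup>2 + 2 * (cmod (g z))\<^sup>2"
      using sum_squares_bound[of "cmod (f z)" "cmod (g z)"] by (simp add: power2_sum)
    finally show ?thesis by simp
  qed
  ultimately have "integrable circle (\<lambda>z. (cmod (f z + g z))\<^sup>2)"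
    by - (erule Bochner_Integration.integrable_bound, auto)
  then show ?thesis
    by (auto simp: L2_fun_def)
qed

lemma L2_fun_scale: "f \<in> L2_fun \<Longrightarrow> (\<lambda>z. a * f z) \<in> L2_fun"
  by (auto simp: L2_fun_def norm_mult power_mult_distrib)

lemma L2_fun_minus: "f \<in> L2_fun \<Longrightarrow> (\<lambda>z. - f z) \<in> L2_fun"
  using L2_fun_scale[of f "-1"] by simp

lemma L2_fun_diff: "f \<in> L2_fun \<Longrightarrow> g \<in> L2_fun \<Longrightarrow> (\<lambda>z. f z - g z) \<in> L2_fun"
  using L2_fun_add[OF _ L2_fun_minus, of f g] by simp

lemma integrable_mult_cnj:
  assumes "f \<in> L2_fun" "g \<in> L2_fun"
  shows "integrable circle (\<lambda>z. f z * cnj (g z))"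
proof -
  have m [measurable]: "f \<in> borel_measurable circle" "g \<in> borel_measurable circle"
    using assms by (auto simp: L2_fun_def)
  have c [measurable]: "(\<lambda>z. cnj (g z)) \<in> borel_measurable circle"
    by (rule borel_measurable_continuous_on[OF _ m(2)]) (intro continuous_intros)
  have "integrable circle (\<lambda>z. (cmod (f z))\<^sup>2 + (cmod (g z))\<^sup>2)"
    using assms by (auto simp: L2_fun_def)
  moreover have "norm (f z * cnj (g z)) \<le> norm ((cmod (f z))\<^sup>2 + (cmod (g z))\<^sup>2)" for z
    using sum_squares_bound[of "cmod (f z)" "cmod (g z)"]
      mult_nonneg_nonneg[OF norm_ge_zero[of "f z"] norm_ge_zero[of "g z"]]
    unfolding norm_mult complex_mod_cnj real_norm_def abs_of_nonneg[OF sum_power2_ge_zero]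
    by linarith
  ultimately show ?thesis
    by - (erule Bochner_Integration.integrable_bound, auto)
qed

instantiation L2 :: complex_inner_space
begin

lift_definition zero_L2 :: L2 is "\<lambda>_. 0"
  by (simp add: L2_eq_def zero_in_L2_fun)

lift_definition plus_L2 :: "L2 \<Rightarrow> L2 \<Rightarrow> L2" is "\<lambda>f g z. f z + g z"
  by (auto simp: L2_eq_def L2_fun_add)

lift_definition uminus_L2 :: "L2 \<Rightarrow> L2" is "\<lambda>f z. - f z"
  by (auto simp: L2_eq_def L2_fun_minus)

lift_definition minus_L2 :: "L2 \<Rightarrow> L2 \<Rightarrow> L2" is "\<lambda>f g z. f z - g z"
  by (auto simp: L2_eq_def L2_fun_diff)

lift_definition scaleC_L2 :: "complex \<Rightarrow> L2 \<Rightarrow> L2" is "\<lambda>a f z. a * f z"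
  by (auto simp: L2_eq_def L2_fun_scale)

lift_definition cinner_L2 :: "L2 \<Rightarrow> L2 \<Rightarrow> complex"
  is "\<lambda>f g. LINT z|circle. f z * cnj (g z)"
proof -
  fix f f' g g' assume *: "L2_eq f f'" "L2_eq g g'"
  then have "AE z in circle. f z * cnj (g z) = f' z * cnj (g' z)"
    by (auto simp: L2_eq_def)
  with * show "(LINT z|circle. f z * cnj (g z)) = (LINT z|circle. f' z * cnj (g' z))"
    by (intro integral_cong_AE borel_measurable_integrable integrable_mult_cnj)
       (auto simp: L2_eq_def)
qed

instance
proof
  fix x y z :: L2 and a b :: complex
  show "x + y + z = x + (y + z)"
    by transfer (auto simp: L2_eq_def intro!: L2_fun_add AE_I2)
  show "x + y = y + x"
    by transfer (auto simp: L2_eq_def intro!: L2_fun_add AE_I2)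
  show "0 + x = x"
    by transfer (auto simp: L2_eq_def)
  show "- x + x = 0"
    by transfer (auto simp: L2_eq_def zero_in_L2_fun)
  show "x - y = x + - y"
    by transfer (auto simp: L2_eq_def intro!: L2_fun_diff)
  show "a *\<^sub>C (x + y) = a *\<^sub>C x + a *\<^sub>C y"
    by transfer (auto simp: L2_eq_def algebra_simps intro!: L2_fun_add L2_fun_scale)
  show "(a + b) *\<^sub>C x = a *\<^sub>C x + b *\<^sub>C x"
    by transfer (auto simp: L2_eq_def algebra_simps intro!: L2_fun_add L2_fun_scale)
  show "a *\<^sub>C b *\<^sub>C x = (a * b) *\<^sub>C x"
    by transfer (auto simp: L2_eq_def mult.assoc intro!: L2_fun_scale)
  show "1 *\<^sub>C x = x"
    by transfer (auto simp: L2_eq_def)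
  show "cinner x y = cnj (cinner y x)"
    by transfer (simp add: mult.commute flip: Bochner_Integration.integral_cnj)
  show "cinner (x + y) z = cinner x z + cinner y z"
    by transfer (simp add: L2_eq_def distrib_right integrable_mult_cnj)
  show "cinner (a *\<^sub>C x) y = a * cinner x y"
    by transfer (simp add: mult.assoc)
  have sq: "cinner x x = of_real (LINT z|circle. (cmod (rep_L2 x z))\<^sup>2)"
    by (simp add: cinner_L2.rep_eq flip: complex_norm_square integral_complex_of_real)
  then show "0 \<le> Re (cinner x x)"
    by simp
  show "cinner x x = 0 \<longleftrightarrow> x = 0"
  proof transfer
    fix f assume "L2_eq f f"
    then have f: "f \<in> L2_fun"
      by (simp add: L2_eq_def)
    then have "integrable circle (\<lambda>z. (cmod (f z))\<^sup>2)"
      by (simp add: L2_fun_def)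
    then have "(LINT z|circle. (cmod (f z))\<^sup>2) = 0 \<longleftrightarrow> (AE z in circle. (cmod (f z))\<^sup>2 = 0)"
      by (intro integral_nonneg_eq_0_iff_AE) auto
    moreover have "(LINT z|circle. f z * cnj (f z)) = of_real (LINT z|circle. (cmod (f z))\<^sup>2)"
      by (simp flip: complex_norm_square integral_complex_of_real)
    ultimately show "(LINT z|circle. f z * cnj (f z)) = 0 \<longleftrightarrow> L2_eq f (\<lambda>_. 0)"
      using f by (simp add: L2_eq_def zero_in_L2_fun)
  qed
qed

end


section \<open>Operators\<close>

definition even_part :: "(complex \<Rightarrow> complex) \<Rightarrow> complex \<Rightarrow> complex" where
  "even_part f z = (f z + f (- z)) / 2"

definition odd_part :: "(complex \<Rightarrow> complex) \<Rightarrow> complex \<Rightarrow> complex" where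
  "odd_part f z = (f z - f (- z)) / 2"

text \<open>
  The operators below act on a representative \<open>rep_L2 F\<close> of the class \<open>F\<close>.  The choice of the
  representative is irrelevant because the maps \<open>z \<mapsto> - z\<close> and \<open>z \<mapsto> cnj z\<close> preserve the measure
  on the circle.  \<open>Mult\<close> and \<open>Mult_eo\<close> are meaningful for symbols in \<open>Linf_fun\<close>, for which the
  resulting function is square integrable; \<open>abs_L2\<close> is unspecified outside \<open>L2_fun\<close>.
\<close>

definition Mult :: "(complex \<Rightarrow> complex) \<Rightarrow> L2 \<Rightarrow> L2" where
  "Mult \<phi> F = abs_L2 (\<lambda>z. \<phi> z * rep_L2 F z)"

definition Mult_eo :: "(complex \<Rightarrow> complex) \<Rightarrow> (complex \<Rightarrow> complex) \<Rightarrow> L2 \<Rightarrow> L2" where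
  "Mult_eo \<phi>\<^sub>1 \<phi>\<^sub>2 F =
     abs_L2 (\<lambda>z. \<phi>\<^sub>1 z * even_part (rep_L2 F) z + \<phi>\<^sub>2 z * odd_part (rep_L2 F) z)"

definition Jstar :: "L2 \<Rightarrow> L2" where
  "Jstar F = abs_L2 (\<lambda>z. cnj (rep_L2 F (cnj z)))"

end

theory Submission
  imports Defs
begin

text \<open>
  Since \<open>C\<close> commutes with all multiplications by \<open>z powi (2 * n)\<close>, the identities
  \<open>\<langle>C (z\<^sup>2\<^sup>n f), g\<rangle> = \<langle>C g, z\<^sup>2\<^sup>n f\<rangle>\<close> and \<open>\<langle>C (z\<^sup>2\<^sup>n f), C g\<rangle> = \<langle>g, z\<^sup>2\<^sup>n f\<rangle>\<close> equate the even Fourier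
  coefficients of two integrable functions.  As an integrable function is determined by its
  Fourier coefficients, for all \<open>f\<close> and \<open>g\<close> the following pairs of functions have almost
  everywhere equal even parts: \<open>C g \<cdot> cnj f\<close> and the reflection of \<open>C f \<cdot> cnj g\<close> under \<open>z \<mapsto> cnj z\<close>;
  \<open>C f \<cdot> cnj (C g)\<close> and the reflection of \<open>g \<cdot> cnj f\<close>.  With \<open>\<xi>\<^sub>1 = C 1\<close> and \<open>z \<xi>\<^sub>2 = C z\<close>, the choices
  \<open>g = 1\<close> and \<open>g = z\<close> in the first pair yield the formula for \<open>C f\<close> together with the symmetry
  relations, and the choices \<open>f, g \<in> {1, z}\<close> in the second yield the relations between the moduli.
\<close>

subsection \<open>Measure on the circle\<close>

lemma space_circle: "space circle = sphere 0 1"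
  by (simp add: circle_def space_restrict_space)

lemma sets_circle: "sets circle = sets (restrict_space borel (sphere 0 1))"
  by (simp add: circle_def)

lemma measurable_cis_circle [measurable]: "cis \<in> borel \<rightarrow>\<^sub>M circle"
proof -
  have "cis \<in> borel \<rightarrow>\<^sub>M restrict_space borel (sphere 0 1)"
    by (rule measurable_restrict_space2)
      (auto intro!: borel_measurable_continuous_onI continuous_intros)
  then show ?thesis
    by (simp cong: measurable_cong_sets add: sets_circle)
qed

lemma measurable_circleI:
  assumes "f \<in> borel \<rightarrow>\<^sub>M borel"
  shows "f \<in> circle \<rightarrow>\<^sub>M borel"
proof -
  have "f \<in> restrict_space borel (sphere 0 1) \<rightarrow>\<^sub>M borel"
    using assms by (rule measurable_restrict_space1)
  then show ?thesis
    by (simp cong: measurable_cong_sets add: sets_circle)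
qed

lemma measurable_circle_circleI:
  assumes "f \<in> borel \<rightarrow>\<^sub>M borel" "\<And>z. cmod z = 1 \<Longrightarrow> cmod (f z) = 1"
  shows "f \<in> circle \<rightarrow>\<^sub>M circle"
proof -
  have "f \<in> circle \<rightarrow>\<^sub>M restrict_space borel (sphere 0 1)"
    using assms measurable_circleI by (intro measurable_restrict_space2) (auto simp: space_circle)
  then show ?thesis
    by (simp cong: measurable_cong_sets add: sets_circle)
qed

lemma borel_measurable_cnj: "cnj \<in> borel \<rightarrow>\<^sub>M borel"
  by (intro borel_measurable_continuous_onI continuous_intros)

lemma measurable_uminus_circle [measurable]: "uminus \<in> circle \<rightarrow>\<^sub>M circle"
  by (rule measurable_circle_circleI) auto

lemma measurable_cnj_circle [measurable]: "cnj \<in> circle \<rightarrow>\<^sub>M circle"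
  by (rule measurable_circle_circleI) (auto intro: borel_measurable_cnj)

text \<open>Pulling back along \<open>cis\<close> turns invariance questions on the circle into
  affine substitutions on the line.\<close>

lemma nn_integral_circle:
  assumes [measurable]: "f \<in> borel_measurable circle"
  shows "(\<integral>\<^sup>+z. f z \<partial>circle) =
    (\<integral>\<^sup>+t. f (cis t) * indicator {0..<2 * pi} t \<partial>lborel) / ennreal (2 * pi)"
proof -
  have f: "f \<in> borel_measurable (restrict_space borel (sphere 0 1))"
    using assms by (simp cong: measurable_cong_sets add: sets_circle)
  have c: "cis \<in> uniform_measure lborel {0..<2 * pi} \<rightarrow>\<^sub>M restrict_space borel (sphere 0 1)"
    using measurable_cis_circle by (simp cong: measurable_cong_sets add: sets_circle)
  show ?thesis
    unfolding circle_def using f c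
    by (simp add: nn_integral_distr nn_integral_uniform_measure)
qed

lemma finite_measure_circle: "finite_measure circle"
proof -
  have "cis \<in> uniform_measure lborel {0..<2 * pi} \<rightarrow>\<^sub>M restrict_space borel (sphere 0 1)"
    using measurable_cis_circle by (simp cong: measurable_cong_sets add: sets_circle)
  moreover have "finite_measure (uniform_measure lborel {0..<2 * pi})"
    by (rule finite_measureI) simp
  ultimately show ?thesis
    unfolding circle_def by (intro finite_measure.finite_measure_distr)
qed

interpretation circle: finite_measure circle
  by (rule finite_measure_circle)

section \<open>Invariance of the measure under negation and complex conjugation\<close>

text \<open>Negation is a half turn: in the parameter it exchanges \<open>{0..<pi}\<close> and
  \<open>{pi..<2 * pi}\<close>, each by a translation. Periodicity of \<open>cis\<close> lets the
  shift be \<open>pi\<close> or \<open>- pi\<close>, whichever stays in the interval.\<close>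

lemma nn_integral_circle_uminus:
  assumes [measurable]: "f \<in> borel_measurable circle"
  shows "(\<integral>\<^sup>+z. f (- z) \<partial>circle) = (\<integral>\<^sup>+z. f z \<partial>circle)"
proof -
  define g where "g t = f (cis t)" for t
  have g [measurable]: "g \<in> borel_measurable borel"
    unfolding g_def by measurable
  have g1: "f (- cis t) = g (pi + t)" and g2: "f (- cis t) = g (- pi + t)" for t
    unfolding g_def by (auto intro!: arg_cong[of _ _ f] simp: complex_eq_iff)
  have g3: "g (pi + t) = g (- pi + t)" for t
    using g1 g2 by metis
  have split: "indicator {0..<2 * pi} t = indicator {0..<pi} t + (indicator {pi..<2 * pi} t :: ennreal)" for t
    by (auto simp: indicator_def)
  have "(\<integral>\<^sup>+t. f (- cis t) * indicator {0..<2 * pi} t \<partial>lborel) =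
      (\<integral>\<^sup>+t. g (pi + t) * indicator {pi..<2 * pi} (pi + t)
        + g (- pi + t) * indicator {0..<pi} (- pi + t) \<partial>lborel)"
    by (intro nn_integral_cong) (auto simp: indicator_def g1 g3)
  also have "\<dots> = (\<integral>\<^sup>+t. g t * indicator {pi..<2 * pi} t \<partial>lborel) + (\<integral>\<^sup>+t. g t * indicator {0..<pi} t \<partial>lborel)"
    using nn_integral_real_affine[of "\<lambda>t. g t * indicator {pi..<2 * pi} t" 1 pi]
      nn_integral_real_affine[of "\<lambda>t. g t * indicator {0..<pi} t" 1 "- pi"]
    by (simp add: nn_integral_add)
  also have "\<dots> = (\<integral>\<^sup>+t. g t * indicator {0..<2 * pi} t \<partial>lborel)"
    by (simp add: nn_integral_add split distrib_left add.commute)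
  finally show ?thesis
    by (simp add: nn_integral_circle g_def)
qed

text \<open>In the parameter, conjugation is the reflection of t to 2 pi - t, which preserves
  Lebesgue measure.\<close>

lemma nn_integral_circle_cnj:
  assumes [measurable]: "f \<in> borel_measurable circle"
  shows "(\<integral>\<^sup>+z. f (cnj z) \<partial>circle) = (\<integral>\<^sup>+z. f z \<partial>circle)"
proof -
  define g where "g t = f (cis t)" for t
  have g [measurable]: "g \<in> borel_measurable borel"
    unfolding g_def by measurable
  have g1: "f (cnj (cis t)) = g (2 * pi + (-1) * t)" for t
    unfolding g_def by (auto intro!: arg_cong[of _ _ f] simp: complex_eq_iff)
  have "(\<integral>\<^sup>+t. f (cnj (cis t)) * indicator {0..<2 * pi} t \<partial>lborel) =
      (\<integral>\<^sup>+t. g (2 * pi + (-1) * t) * indicator {0..<2 * pi} (2 * pi + (-1) * t) \<partial>lborel)"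
  proof (rule nn_integral_cong_AE)
    \<comment> \<open>The reflection carries \<open>{0..<2 * pi}\<close> to the interval closed at
      the other end, so the indicators differ exactly at the two endpoints.\<close>
    have "AE t in lborel. t \<noteq> 0 \<and> t \<noteq> 2 * pi"
      using AE_lborel_singleton[of "0::real"] AE_lborel_singleton[of "2 * pi"] by eventually_elim auto
    then show "AE t in lborel. f (cnj (cis t)) * indicator {0..<2 * pi} t =
        g (2 * pi + (-1) * t) * indicator {0..<2 * pi} (2 * pi + (-1) * t)"
      by eventually_elim (auto simp: indicator_def g1)
  qed
  also have "\<dots> = (\<integral>\<^sup>+t. g t * indicator {0..<2 * pi} t \<partial>lborel)"
    using nn_integral_real_affine[of "\<lambda>t. g t * indicator {0..<2 * pi} t" "-1" "2 * pi"] by simp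
  finally show ?thesis
    by (simp add: nn_integral_circle g_def)
qed

text \<open>Invariance as an equality of measures, rather than of nonnegative integrals, transfers
  to almost everywhere statements and to integrals of complex functions.\<close>

lemma distr_circle_uminus: "distr circle circle uminus = circle"
proof (rule measure_eqI)
  fix A assume "A \<in> sets (distr circle circle uminus)"
  then have A [measurable]: "A \<in> sets circle"
    by simp
  have "emeasure (distr circle circle uminus) A = (\<integral>\<^sup>+z. indicator A z \<partial>distr circle circle uminus)"
    by simp
  also have "\<dots> = (\<integral>\<^sup>+z. indicator A (- z) \<partial>circle)"
    by (subst nn_integral_distr) auto
  finally show "emeasure (distr circle circle uminus) A = emeasure circle A"
    by (simp add: nn_integral_circle_uminus)
qed simp

lemma distr_circle_cnj: "distr circle circle cnj = circle"
proof (rule measure_eqI)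
  fix A assume "A \<in> sets (distr circle circle cnj)"
  then have A [measurable]: "A \<in> sets circle"
    by simp
  have "emeasure (distr circle circle cnj) A = (\<integral>\<^sup>+z. indicator A z \<partial>distr circle circle cnj)"
    by simp
  also have "\<dots> = (\<integral>\<^sup>+z. indicator A (cnj z) \<partial>circle)"
    by (subst nn_integral_distr) auto
  finally show "emeasure (distr circle circle cnj) A = emeasure circle A"
    by (simp add: nn_integral_circle_cnj)
qed simp

lemma AE_circle_uminus: "AE z in circle. P z \<Longrightarrow> AE z in circle. P (- z)"
  using AE_distrD[OF measurable_uminus_circle, of P] by (simp only: distr_circle_uminus)

lemma AE_circle_cnj: "AE z in circle. P z \<Longrightarrow> AE z in circle. P (cnj z)"
  using AE_distrD[OF measurable_cnj_circle, of P] by (simp only: distr_circle_cnj)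

lemma integral_circle_uminus:
  fixes f :: "complex \<Rightarrow> 'a::{banach, second_countable_topology}"
  assumes "f \<in> borel_measurable circle"
  shows "(LINT z|circle. f (- z)) = (LINT z|circle. f z)"
  using integral_distr[OF measurable_uminus_circle assms] by (simp add: distr_circle_uminus)

lemma integral_circle_cnj:
  fixes f :: "complex \<Rightarrow> 'a::{banach, second_countable_topology}"
  assumes "f \<in> borel_measurable circle"
  shows "(LINT z|circle. f (cnj z)) = (LINT z|circle. f z)"
  using integral_distr[OF measurable_cnj_circle assms] by (simp only: distr_circle_cnj)

lemma integrable_circle_uminus:
  fixes f :: "complex \<Rightarrow> 'a::{banach, second_countable_topology}"
  assumes "integrable circle f"
  shows "integrable circle (\<lambda>z. f (- z))"
  using integrable_distr[OF measurable_uminus_circle, of f] assms by (simp add: distr_circle_uminus)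

lemma integrable_circle_cnj:
  fixes f :: "complex \<Rightarrow> 'a::{banach, second_countable_topology}"
  assumes "integrable circle f"
  shows "integrable circle (\<lambda>z. f (cnj z))"
  using integrable_distr[OF measurable_cnj_circle, of f] assms by (simp add: distr_circle_cnj)

subsection \<open>Uniqueness of Fourier coefficients\<close>

lemma integrable_circle_bounded_mult:
  fixes f g :: "complex \<Rightarrow> complex"
  assumes "integrable circle f" "g \<in> borel_measurable circle" "AE z in circle. cmod (g z) \<le> K"
  shows "integrable circle (\<lambda>z. g z * f z)"
proof (rule Bochner_Integration.integrable_bound)
  show "integrable circle (\<lambda>z. of_real K * f z)"
    using assms(1) by simp
  show "(\<lambda>z. g z * f z) \<in> borel_measurable circle"
    using assms by simp
  show "AE z in circle. norm (g z * f z) \<le> norm (of_real K * f z)"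
    using assms(3)
  proof eventually_elim
    case (elim z)
    then have "cmod (g z) \<le> \<bar>K\<bar>" by simp
    then show ?case by (simp add: norm_mult mult_right_mono)
  qed
qed

text \<open>Integer exponents cover the Fourier coefficients of both signs. Only integrability is
  asked, since the notion is meant for combinations of products of two square integrable
  functions.\<close>

definition fourier_null :: "(complex \<Rightarrow> complex) \<Rightarrow> bool" where
  "fourier_null h \<longleftrightarrow> integrable circle h \<and> (\<forall>n. (LINT z|circle. z powi n * h z) = 0)"

lemma borel_measurable_powi [measurable]: "(\<lambda>z. z powi n) \<in> circle \<rightarrow>\<^sub>M (borel :: complex measure)"
  by (rule measurable_circleI) (simp add: power_int_def)

lemma AE_circleI: "(\<And>z. cmod z = 1 \<Longrightarrow> P z) \<Longrightarrow> AE z in circle. P z"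
  by (rule AE_I2) (simp add: space_circle)

lemma norm_powi_circle: "cmod z = 1 \<Longrightarrow> cmod (z powi n) = 1"
  by (simp add: norm_power_int)

lemma integrable_powi_mult: "integrable circle h \<Longrightarrow> integrable circle (\<lambda>z. z powi n * h z)"
  by (rule integrable_circle_bounded_mult[where K = 1])
    (auto intro!: AE_circleI simp: norm_powi_circle)

lemma circle_powi_add: "cmod z = 1 \<Longrightarrow> z powi (m + n) = z powi m * z powi n"
  by (rule power_int_add) auto

lemma inverse_circle: "cmod z = 1 \<Longrightarrow> inverse z = cnj z"
  by (metis complex_div_cnj divide_inverse mult_1 norm_one of_real_1 div_by_1 power_one)

lemma fourier_null_powi: "fourier_null h \<Longrightarrow> fourier_null (\<lambda>z. z powi m * h z)"
  unfolding fourier_null_def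
proof (intro conjI allI)
  fix n assume h: "integrable circle h \<and> (\<forall>n. (LINT z|circle. z powi n * h z) = 0)"
  show "integrable circle (\<lambda>z. z powi m * h z)"
    using h integrable_powi_mult by blast
  have "(LINT z|circle. z powi n * (z powi m * h z)) = (LINT z|circle. z powi (n + m) * h z)"
    by (intro Bochner_Integration.integral_cong refl)
      (auto simp: space_circle circle_powi_add)
  then show "(LINT z|circle. z powi n * (z powi m * h z)) = 0"
    using h by simp
qed

lemma fourier_null_add:
  assumes "fourier_null h" "fourier_null k"
  shows "fourier_null (\<lambda>z. h z + k z)"
  using assms by (auto simp: fourier_null_def distrib_left integrable_powi_mult)

lemma fourier_null_cmult:
  assumes "fourier_null h"
  shows "fourier_null (\<lambda>z. c * h z)"
  using assms by (auto simp: fourier_null_def mult.left_commute[of _ c])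

lemma fourier_null_cong:
  assumes "fourier_null h" "\<And>z. cmod z = 1 \<Longrightarrow> h z = k z"
  shows "fourier_null k"
proof -
  have "integrable circle k"
    using assms Bochner_Integration.integrable_cong[of circle circle h k]
    by (auto simp: fourier_null_def space_circle)
  moreover have "(LINT z|circle. z powi n * h z) = (LINT z|circle. z powi n * k z)" for n
    using assms(2) by (intro Bochner_Integration.integral_cong) (auto simp: space_circle)
  ultimately show ?thesis
    using assms by (auto simp: fourier_null_def)
qed

text \<open>On the circle the real and imaginary parts of z are combinations of z and its inverse,
  and multiplication by these only shifts Fourier coefficients. The function \<open>h\<close> is
  generalized because the product case applies one induction hypothesis to the result of the
  other.\<close>

lemma fourier_null_real_polynomial_mult:
  assumes "real_polynomial_function p" "fourier_null h"
  shows "fourier_null (\<lambda>z. of_real (p z) * h z)"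
  using assms
proof (induction arbitrary: h)
  case (linear f)
  \<comment> \<open>These come from f z = x f(1) + y f(i) with x = (z + 1/z)/2 and y = (z -
    1/z)/(2i), after collecting the terms in z and 1/z. The map \<open>f\<close> is only real
    linear, so both values enter.\<close>
  define \<alpha> \<beta> where "\<alpha> = of_real (f 1) / 2 + of_real (f \<i>) / (2 * \<i>)"
    and "\<beta> = of_real (f 1) / 2 - of_real (f \<i>) / (2 * \<i>)"
  have "fourier_null (\<lambda>z. \<alpha> * (z powi 1 * h z) + \<beta> * (z powi (-1) * h z))"
    using linear by (intro fourier_null_add fourier_null_cmult fourier_null_powi)
  then show ?case
  proof (rule fourier_null_cong)
    fix z :: complex assume z: "cmod z = 1"
    interpret f: bounded_linear f by fact
    have "z = Re z *\<^sub>R 1 + Im z *\<^sub>R \<i>"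
      by (simp add: complex_eq_iff)
    then have "f z = Re z * f 1 + Im z * f \<i>"
      by (metis f.add f.scaleR real_scaleR_def)
    moreover have "inverse z = cnj z"
      using z by (rule inverse_circle)
    moreover have "\<alpha> * z + \<beta> * cnj z = of_real (Re z * f 1 + Im z * f \<i>)"
      by (simp add: \<alpha>_def \<beta>_def complex_eq_iff Re_divide Im_divide power2_eq_square algebra_simps)
    ultimately have "\<alpha> * z + \<beta> * inverse z = of_real (f z)"
      by simp
    then show "\<alpha> * (z powi 1 * h z) + \<beta> * (z powi (-1) * h z) = of_real (f z) * h z"
      by (simp add: power_int_minus flip: mult.assoc distrib_right)
  qed
next
  case (const c)
  then show ?case by (rule fourier_null_cmult)
next
  case (add f g)
  then show ?case by (simp add: distrib_right fourier_null_add)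
next
  case (mult f g)
  then show ?case by (simp add: mult.assoc)
qed

text \<open>By Stone-Weierstrass, \<open>f\<close> is uniformly close on the circle to a polynomial
  \<open>p\<close>, and the integral of \<open>p\<close> against \<open>h\<close> vanishes. The
  remaining error is at most e times the integral of |h|.\<close>

lemma fourier_null_continuous_integral:
  fixes f :: "complex \<Rightarrow> real"
  assumes h: "fourier_null h" and f: "continuous_on UNIV f"
  shows "(LINT z|circle. of_real (f z) * h z) = 0"
proof -
  have ih: "integrable circle h"
    using h by (simp add: fourier_null_def)
  have [measurable]: "f \<in> borel_measurable circle"
    using f by (intro measurable_circleI borel_measurable_continuous_onI)
  have "bounded (f ` sphere 0 1)"
    using f by (intro compact_imp_bounded compact_continuous_image continuous_on_subset[OF f]) auto
  then obtain K where K: "\<forall>z\<in>sphere 0 1. norm (f z) \<le> K"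
    by (auto simp: bounded_iff)
  have if': "integrable circle (\<lambda>z. of_real (f z) * h z)"
    using ih K by (intro integrable_circle_bounded_mult[where K = K] AE_circleI) auto
  have "cmod (LINT z|circle. of_real (f z) * h z) \<le> e * (LINT z|circle. cmod (h z))" if e: "e > 0" for e
  proof -
    obtain p where p: "real_polynomial_function p" "\<And>z. z \<in> sphere 0 1 \<Longrightarrow> \<bar>f z - p z\<bar> < e"
      using Stone_Weierstrass_real_polynomial_function[OF compact_sphere continuous_on_subset[OF f subset_UNIV] e]
      by metis
    have np: "fourier_null (\<lambda>z. of_real (p z) * h z)"
      using p(1) h by (rule fourier_null_real_polynomial_mult)
    then have ip: "integrable circle (\<lambda>z. of_real (p z) * h z)"
      by (simp add: fourier_null_def)
    have "(LINT z|circle. of_real (p z) * h z) = 0"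
      using np[unfolded fourier_null_def] by (auto dest: spec[of _ 0])
    then have "(LINT z|circle. of_real (f z) * h z) = (LINT z|circle. of_real (f z) * h z - of_real (p z) * h z)"
      using if' ip by simp
    also have "cmod \<dots> \<le> (LINT z|circle. e * cmod (h z))"
    proof (rule Bochner_Integration.integral_norm_bound_integral)
      fix z assume "z \<in> space circle"
      then have "\<bar>f z - p z\<bar> \<le> e"
        using p(2)[of z] by (simp add: space_circle)
      then have "cmod (of_real (f z - p z) * h z) \<le> e * cmod (h z)"
        by (simp add: norm_mult mult_right_mono del: of_real_diff)
      then show "norm (of_real (f z) * h z - of_real (p z) * h z) \<le> e * cmod (h z)"
        by (simp add: left_diff_distrib)
    qed (use if' ip ih in auto)
    finally show ?thesis by simp
  qed
  then have le: "x \<le> e * y" if "e > 0" "x = cmod (LINT z|circle. of_real (f z) * h z)"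
    "y = (LINT z|circle. cmod (h z))" for e x y
    using that by blast
  show ?thesis
  proof (rule ccontr)
    assume nz: "(LINT z|circle. of_real (f z) * h z) \<noteq> 0"
    define x y where "x = cmod (LINT z|circle. of_real (f z) * h z)"
      and "y = (LINT z|circle. cmod (h z))"
    have "x > 0" "y \<ge> 0"
      using nz by (simp_all add: x_def y_def)
    \<comment> \<open>The choice e = x / (y + 1) also covers y = 0; it gives x (y + 1) \<le> x y,
      which is absurd for positive x.\<close>
    then have "x \<le> x / (y + 1) * y"
      by (intro le x_def y_def) simp
    then show False
      using \<open>x > 0\<close> \<open>y \<ge> 0\<close> by (simp add: field_simps)
  qed
qed

text \<open>The indicator of a closed set is the pointwise limit of the continuous functions max(0,
  1 - n dist(z, K)), and |h| dominates.\<close>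

lemma fourier_null_closed_integral:
  assumes h: "fourier_null h" and K: "closed K"
  shows "(LINT z|circle. indicator K z *\<^sub>R h z) = 0"
proof (cases "K = {}")
  \<comment> \<open>The empty set is separated because \<open>infdist\<close> to it is 0 by
    convention, which would make the approximating functions constantly 1.\<close>
  case False
  have ih: "integrable circle h"
    using h by (simp add: fourier_null_def)
  define f where "f n z = max 0 (1 - real n * infdist z K)" for n z
  have cont: "continuous_on UNIV (f n)" for n
    unfolding f_def by (intro continuous_intros)
  have [measurable]: "f n \<in> borel_measurable circle" for n
    using cont by (intro measurable_circleI borel_measurable_continuous_onI)
  have [measurable]: "(indicator K :: complex \<Rightarrow> real) \<in> borel_measurable circle"
    using K by (intro measurable_circleI) simp
  have lim: "(\<lambda>n. f n z) \<longlonglongrightarrow> indicator K z" for z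
  proof (cases "z \<in> K")
    case True
    then show ?thesis by (simp add: f_def)
  next
    case False
    then have pos: "infdist z K > 0"
      using K \<open>K \<noteq> {}\<close> by (metis in_closed_iff_infdist_zero infdist_nonneg less_eq_real_def)
    obtain N where N: "1 < real N * infdist z K"
      using reals_Archimedean3[OF pos] by blast
    have "f n z = 0" if "n \<ge> N" for n
    proof -
      have "real N * infdist z K \<le> real n * infdist z K"
        using that pos by (intro mult_right_mono) auto
      with N show ?thesis by (simp add: f_def)
    qed
    then have "\<forall>\<^sub>F n in sequentially. f n z = 0"
      by (rule eventually_sequentiallyI)
    then show ?thesis
      using False by (simp add: tendsto_eventually)
  qed
  have "(\<lambda>n. LINT z|circle. of_real (f n z) * h z) \<longlonglongrightarrow> (LINT z|circle. indicator K z *\<^sub>R h z)"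
  proof (rule integral_dominated_convergence[where w = "\<lambda>z. cmod (h z)"])
    show "AE z in circle. (\<lambda>n. of_real (f n z) * h z) \<longlonglongrightarrow> indicator K z *\<^sub>R h z"
      using lim by (intro AE_I2) (auto simp flip: scaleR_conv_of_real intro!: tendsto_intros)
    show "AE z in circle. norm (of_real (f n z) * h z) \<le> cmod (h z)" for n
      by (intro AE_I2) (auto simp: norm_mult f_def max_def infdist_nonneg intro!: mult_left_le_one_le)
  qed (use ih in auto)
  then show ?thesis
    using fourier_null_continuous_integral[OF h cont] by (simp add: LIMSEQ_const_iff)
qed simp

text \<open>Closed sets form an intersection-stable generator of the Borel sets, so vanishing of the
  integral extends from them to all Borel sets by a Dynkin argument. A function whose integral over
  every measurable set is zero vanishes almost everywhere.\<close>

theorem fourier_null_AE_zero: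
  assumes h: "fourier_null h"
  shows "AE z in circle. h z = 0"
proof (rule circle.density_zero)
  show ih: "integrable circle h"
    using h by (simp add: fourier_null_def)
  have [measurable]: "A \<in> sets borel \<Longrightarrow> (indicator A :: complex \<Rightarrow> real) \<in> borel_measurable circle" for A
    by (intro measurable_circleI) simp
  have ind: "integrable circle (\<lambda>z. indicator A z *\<^sub>R h z)" if "A \<in> sets borel" for A
    using that ih by (intro Bochner_Integration.integrable_bound[OF ih]) (auto split: split_indicator)
  have borel: "(LINT z|circle. indicator A z *\<^sub>R h z) = 0" if "A \<in> sigma_sets UNIV (Collect closed)" for A
  proof -
    have sb: "sigma_sets UNIV (Collect closed) = sets (borel :: complex measure)"
      by (simp add: borel_eq_closed)
    have "Int_stable (Collect closed)" "Collect closed \<subseteq> Pow UNIV"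
      by (auto simp: Int_stable_def)
    then show ?thesis
      using that
    proof (induction rule: sigma_sets_induct_disjoint)
      case (basic A)
      then show ?case using h by (simp add: fourier_null_closed_integral)
    next
      case empty
      then show ?case by simp
    next
      \<comment> \<open>The whole plane is closed, so the integral of \<open>h\<close> itself is
        zero.\<close>
      case (compl A)
      have "(LINT z|circle. indicator (UNIV - A) z *\<^sub>R h z) = (LINT z|circle. h z - indicator A z *\<^sub>R h z)"
        by (intro Bochner_Integration.integral_cong) (auto simp: indicator_def)
      also have "\<dots> = 0"
        using compl ih ind sb fourier_null_closed_integral[OF h closed_UNIV] by simp
      finally show ?case .
    next
      case (union A)
      have A: "A i \<in> sets borel" for i
        using union(2) by (auto simp: sb)
      have "(\<lambda>n. LINT z|circle. indicator (\<Union>i<n. A i) z *\<^sub>R h z)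
          \<longlonglongrightarrow> (LINT z|circle. indicator (\<Union>i. A i) z *\<^sub>R h z)"
      proof (rule integral_dominated_convergence[where w = "\<lambda>z. cmod (h z)"])
        show "AE z in circle. (\<lambda>n. indicator (\<Union>i<n. A i) z *\<^sub>R h z) \<longlonglongrightarrow> indicator (\<Union>i. A i) z *\<^sub>R h z"
          using LIMSEQ_indicator_UN[of A] by (intro AE_I2 tendsto_intros) auto
      qed (use ih A in \<open>auto split: split_indicator\<close>)
      moreover have "(LINT z|circle. indicator (\<Union>i<n. A i) z *\<^sub>R h z) = 0" for n
      proof -
        have "(LINT z|circle. indicator (\<Union>i<n. A i) z *\<^sub>R h z)
            = (LINT z|circle. (\<Sum>i<n. indicator (A i) z *\<^sub>R h z))"
          using union(1)
          by (subst indicator_UN_disjoint) (auto simp: scaleR_sum_left intro: disjoint_family_on_mono)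
        also have "\<dots> = (\<Sum>i<n. LINT z|circle. indicator (A i) z *\<^sub>R h z)"
          using A ind by (intro Bochner_Integration.integral_sum) auto
        finally show ?thesis
          using union(3) by simp
      qed
      ultimately show ?case
        by (simp add: LIMSEQ_const_iff)
    qed
  qed
  show "(LINT z:A|circle. h z) = 0" if A: "A \<in> sets circle" for A
  proof -
    \<comment> \<open>Measurable subsets of the circle are traces of Borel sets on the sphere, which
      is itself Borel in the plane.\<close>
    have "A \<in> sets borel"
      using A by (auto simp: sets_circle sets_restrict_space)
    then have "A \<in> sigma_sets UNIV (Collect closed)"
      by (simp add: borel_eq_closed)
    then show ?thesis
      using borel by (simp add: set_lebesgue_integral_def)
  qed
qed

text \<open>Replacing z by -z multiplies the integral against z^m by (-1)^m. Passing to the even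
  part thus kills the odd coefficients, and the hypothesis kills the even ones.\<close>

lemma fourier_null_even_part:
  assumes h: "integrable circle h" and z: "\<And>n. (LINT z|circle. z powi (2 * n) * h z) = 0"
  shows "AE z in circle. even_part h z = 0"
proof (rule fourier_null_AE_zero)
  have ih: "integrable circle (\<lambda>z. h (- z))"
    using h by (rule integrable_circle_uminus)
  have i: "integrable circle (even_part h)"
    using h ih unfolding even_part_def by simp
  have "(LINT z|circle. z powi m * even_part h z) = 0" for m
  proof -
    have hm: "h \<in> borel_measurable circle"
      using h by simp
    have "(LINT z|circle. z powi m * h (- z)) = (LINT z|circle. (- z) powi m * h z)"
      using integral_circle_uminus[of "\<lambda>z. (- z) powi m * h z"] hm
      by (simp add: measurable_compose[OF measurable_uminus_circle borel_measurable_powi])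
    also have "\<dots> = (LINT z|circle. (-1) powi m * (z powi m * h z))"
      by (intro Bochner_Integration.integral_cong refl)
        (metis minus_one_mult_self mult.assoc mult_minus1 power_int_mult_distrib)
    finally have "(LINT z|circle. z powi m * h (- z)) = (-1) powi m * (LINT z|circle. z powi m * h z)"
      by simp
    then have "(LINT z|circle. z powi m * even_part h z) =
        (1 + (-1) powi m) / 2 * (LINT z|circle. z powi m * h z)"
      using integrable_powi_mult[OF h] integrable_powi_mult[OF ih]
      by (simp add: even_part_def distrib_left field_simps)
    then show ?thesis
      using z[of "m div 2"] by (cases "even m") (auto simp: power_int_minus_left)
  qed
  then show "fourier_null (even_part h)"
    using i by (simp add: fourier_null_def)
qed

subsection \<open>Operators on \<open>L2\<close>\<close>

lemma rep_L2_fun: "rep_L2 F \<in> L2_fun"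
  using Quotient_rep_reflp[OF Quotient_L2] by (simp add: L2_eq_def)

lemma rep_abs_L2: "f \<in> L2_fun \<Longrightarrow> AE z in circle. rep_L2 (abs_L2 f) z = f z"
  using rep_abs_rsp_left[OF Quotient3_L2, of f f] by (simp add: L2_eq_def)

lemma L2_eqI: "AE z in circle. rep_L2 F z = rep_L2 G z \<Longrightarrow> F = G"
  using Quotient_rel_rep[OF Quotient_L2, of F G] by (simp add: L2_eq_def rep_L2_fun)

lemma Linf_mult_L2_fun:
  assumes "\<phi> \<in> Linf_fun" "f \<in> L2_fun"
  shows "(\<lambda>z. \<phi> z * f z) \<in> L2_fun"
proof -
  obtain K where K: "AE z in circle. cmod (\<phi> z) \<le> K"
    using assms(1) by (auto simp: Linf_fun_def)
  have [measurable]: "\<phi> \<in> borel_measurable circle" "f \<in> borel_measurable circle"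
    using assms by (auto simp: Linf_fun_def L2_fun_def)
  have "integrable circle (\<lambda>z. (cmod (\<phi> z * f z))\<^sup>2)"
  proof (rule Bochner_Integration.integrable_bound)
    show "integrable circle (\<lambda>z. K\<^sup>2 * (cmod (f z))\<^sup>2)"
      using assms(2) by (simp add: L2_fun_def)
    show "AE z in circle. norm ((cmod (\<phi> z * f z))\<^sup>2) \<le> norm (K\<^sup>2 * (cmod (f z))\<^sup>2)"
      using K by eventually_elim (simp add: norm_mult power_mult_distrib power_mono mult_right_mono)
  qed simp
  then show ?thesis
    by (simp add: L2_fun_def)
qed

lemma L2_fun_uminus_arg: "f \<in> L2_fun \<Longrightarrow> (\<lambda>z. f (- z)) \<in> L2_fun"
  using integrable_circle_uminus[of "\<lambda>z. (cmod (f z))\<^sup>2"]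
  by (auto simp: L2_fun_def intro: measurable_compose[OF measurable_uminus_circle])

lemma L2_fun_cnj_arg: "f \<in> L2_fun \<Longrightarrow> (\<lambda>z. f (cnj z)) \<in> L2_fun"
  using integrable_circle_cnj[of "\<lambda>z. (cmod (f z))\<^sup>2"]
  by (auto simp: L2_fun_def intro: measurable_compose[OF measurable_cnj_circle])

lemma L2_fun_cnj: "f \<in> L2_fun \<Longrightarrow> (\<lambda>z. cnj (f z)) \<in> L2_fun"
  using measurable_compose[OF _ borel_measurable_cnj, of f circle] by (simp add: L2_fun_def)

lemma L2_fun_even_part: "f \<in> L2_fun \<Longrightarrow> even_part f \<in> L2_fun"
  unfolding even_part_def
  using L2_fun_scale[OF L2_fun_add[OF _ L2_fun_uminus_arg, of f f], of "1/2"] by simp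

lemma L2_fun_odd_part: "f \<in> L2_fun \<Longrightarrow> odd_part f \<in> L2_fun"
  unfolding odd_part_def
  using L2_fun_scale[OF L2_fun_diff[OF _ L2_fun_uminus_arg, of f f], of "1/2"] by simp

lemma Linf_fun_powi: "(\<lambda>z. z powi n) \<in> Linf_fun"
  unfolding Linf_fun_def by (auto intro!: exI[of _ 1] AE_circleI simp: norm_powi_circle)

lemma Linf_fun_power: "(\<lambda>z. z ^ n) \<in> Linf_fun"
  using Linf_fun_powi[of "int n"] by simp

lemma rep_Mult:
  "\<phi> \<in> Linf_fun \<Longrightarrow> AE z in circle. rep_L2 (Mult \<phi> F) z = \<phi> z * rep_L2 F z"
  unfolding Mult_def by (intro rep_abs_L2 Linf_mult_L2_fun rep_L2_fun)

lemma rep_Jstar: "AE z in circle. rep_L2 (Jstar F) z = cnj (rep_L2 F (cnj z))"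
  unfolding Jstar_def by (intro rep_abs_L2 L2_fun_cnj L2_fun_cnj_arg[of "rep_L2 F"] rep_L2_fun)

lemma rep_Mult_eo:
  assumes "\<xi>\<^sub>1 \<in> Linf_fun" "\<xi>\<^sub>2 \<in> Linf_fun"
  shows "AE z in circle. rep_L2 (Mult_eo \<xi>\<^sub>1 \<xi>\<^sub>2 F) z =
    \<xi>\<^sub>1 z * even_part (rep_L2 F) z + \<xi>\<^sub>2 z * odd_part (rep_L2 F) z"
  unfolding Mult_eo_def using assms
  by (intro rep_abs_L2 L2_fun_add Linf_mult_L2_fun L2_fun_even_part L2_fun_odd_part rep_L2_fun)

text \<open>Since cnj (-z) = - cnj z, only the values at \<open>cnj z\<close> and
  \<open>- cnj z\<close> enter; both directions of the theorem work with this pointwise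
  form.\<close>

lemma rep_Mult_eo_Jstar:
  assumes "\<xi>\<^sub>1 \<in> Linf_fun" "\<xi>\<^sub>2 \<in> Linf_fun"
  shows "AE z in circle. rep_L2 (Mult_eo \<xi>\<^sub>1 \<xi>\<^sub>2 (Jstar F)) z =
    \<xi>\<^sub>1 z * ((cnj (rep_L2 F (cnj z)) + cnj (rep_L2 F (- cnj z))) / 2) +
    \<xi>\<^sub>2 z * ((cnj (rep_L2 F (cnj z)) - cnj (rep_L2 F (- cnj z))) / 2)"
  using rep_Mult_eo[OF assms, of "Jstar F"] rep_Jstar[of F] AE_circle_uminus[OF rep_Jstar[of F]]
  by eventually_elim (simp add: even_part_def odd_part_def)

lemma Mult_Mult:
  assumes "\<phi> \<in> Linf_fun" "\<psi> \<in> Linf_fun" "\<omega> \<in> Linf_fun"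
    and "\<And>z. cmod z = 1 \<Longrightarrow> \<phi> z * \<psi> z = \<omega> z"
  shows "Mult \<phi> (Mult \<psi> F) = Mult \<omega> F"
proof (rule L2_eqI)
  have "AE z in circle. cmod z = 1"
    by (rule AE_circleI)
  with rep_Mult[OF assms(1), of "Mult \<psi> F"] rep_Mult[OF assms(2), of F] rep_Mult[OF assms(3), of F]
  show "AE z in circle. rep_L2 (Mult \<phi> (Mult \<psi> F)) z = rep_L2 (Mult \<omega> F) z"
    by eventually_elim (simp flip: assms(4))
qed

lemma Mult_powi_Mult_powi: "Mult (\<lambda>z. z powi m) (Mult (\<lambda>z. z powi n) F) = Mult (\<lambda>z. z powi (m + n)) F"
  by (rule Mult_Mult) (auto intro: Linf_fun_powi simp: circle_powi_add)

lemma Mult_powi_0: "Mult (\<lambda>z. z powi 0) F = F"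
  by (rule L2_eqI) (use rep_Mult[OF Linf_fun_powi, of 0 F] in simp)

text \<open>Commuting with an invertible operator implies commuting with its inverse, so induction
  can run in both directions from n = 0.\<close>

lemma commute_Mult_powi:
  assumes "C \<circ> Mult (\<lambda>z. z\<^sup>2) = Mult (\<lambda>z. z\<^sup>2) \<circ> C"
  shows "C (Mult (\<lambda>z. z powi (2 * n)) F) = Mult (\<lambda>z. z powi (2 * n)) (C F)"
proof -
  define M where "M k = Mult (\<lambda>z. z powi k)" for k
  have M: "M j (M k G) = M (j + k) G" "M 0 G = G" for j k G
    by (simp_all only: M_def Mult_powi_Mult_powi Mult_powi_0)
  have 1: "C (M 2 G) = M 2 (C G)" for G
    using fun_cong[OF assms, of G] by (simp add: M_def)
  \<comment> \<open>Apply the commutation to \<open>M (- 2) G\<close> and cancel \<open>M 2\<close>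
    from the left.\<close>
  have 2: "C (M (- 2) G) = M (- 2) (C G)" for G
    using arg_cong[OF 1[of "M (- 2) G"], of "M (- 2)"] by (simp add: M)
  have "C (M (2 * n) F) = M (2 * n) (C F)"
  proof (induction n rule: int_induct[where k = 0])
    case base
    then show ?case by (simp add: M)
  next
    case (step1 i)
    have "C (M (2 * (i + 1)) F) = C (M 2 (M (2 * i) F))"
      by (simp add: M algebra_simps)
    also have "\<dots> = M 2 (M (2 * i) (C F))"
      by (simp only: 1 step1.IH)
    also have "\<dots> = M (2 * (i + 1)) (C F)"
      by (simp add: M algebra_simps)
    finally show ?case .
  next
    case (step2 i)
    have "C (M (2 * (i - 1)) F) = C (M (- 2) (M (2 * i) F))"
      by (simp add: M algebra_simps)
    also have "\<dots> = M (- 2) (M (2 * i) (C F))"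
      by (simp only: 2 step2.IH)
    also have "\<dots> = M (2 * (i - 1)) (C F)"
      by (simp add: M algebra_simps)
    finally show ?case .
  qed
  then show ?thesis by (simp add: M_def)
qed

section \<open>Inner products as Fourier coefficients\<close>

lemma cinner_Mult_left:
  assumes "\<phi> \<in> Linf_fun"
  shows "cinner (Mult \<phi> F) G = (LINT z|circle. \<phi> z * (rep_L2 F z * cnj (rep_L2 G z)))"
  unfolding cinner_L2.rep_eq
proof (rule integral_cong_AE)
  show "(\<lambda>z. rep_L2 (Mult \<phi> F) z * cnj (rep_L2 G z)) \<in> borel_measurable circle"
    by (intro borel_measurable_integrable integrable_mult_cnj rep_L2_fun)
  show "(\<lambda>z. \<phi> z * (rep_L2 F z * cnj (rep_L2 G z))) \<in> borel_measurable circle"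
    using assms by (intro borel_measurable_times borel_measurable_integrable[OF integrable_mult_cnj] rep_L2_fun)
      (simp add: Linf_fun_def)
  show "AE z in circle. rep_L2 (Mult \<phi> F) z * cnj (rep_L2 G z) = \<phi> z * (rep_L2 F z * cnj (rep_L2 G z))"
    using rep_Mult[OF assms, of F] by eventually_elim simp
qed

lemma cnj_powi_circle: "cmod z = 1 \<Longrightarrow> cnj (z powi n) = z powi (- n)"
  using inverse_circle[of "z powi n"] by (simp add: norm_powi_circle power_int_minus)

text \<open>On the circle the conjugate of z^n is its inverse, so the adjoint of this unitary
  multiplication is multiplication by z^(-n).\<close>

lemma cinner_Mult_powi_right:
  "cinner F (Mult (\<lambda>z. z powi n) G) = cinner (Mult (\<lambda>z. z powi (- n)) F) G"
proof -
  have "cinner F (Mult (\<lambda>z. z powi n) G) = cnj (cinner (Mult (\<lambda>z. z powi n) G) F)"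
    by (rule cinner_commute)
  also have "\<dots> = (LINT z|circle. cnj (z powi n * (rep_L2 G z * cnj (rep_L2 F z))))"
    by (simp add: cinner_Mult_left Linf_fun_powi flip: Bochner_Integration.integral_cnj)
  also have "\<dots> = (LINT z|circle. z powi (- n) * (rep_L2 F z * cnj (rep_L2 G z)))"
    by (intro Bochner_Integration.integral_cong refl) (simp add: space_circle cnj_powi_circle mult.commute
      flip: complex_cnj_power_int)
  finally show ?thesis
    by (simp add: cinner_Mult_left Linf_fun_powi)
qed

text \<open>Substituting \<open>cnj z\<close> for z reverses the sign of the exponent, so that both
  sides of later comparisons carry the same power of z.\<close>

lemma cinner_Mult_powi_reflect:
  "cinner (Mult (\<lambda>z. z powi (- n)) F) G =
    (LINT z|circle. z powi n * (rep_L2 F (cnj z) * cnj (rep_L2 G (cnj z))))"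
proof -
  have m: "(\<lambda>z. z powi (- n) * (rep_L2 F z * cnj (rep_L2 G z))) \<in> borel_measurable circle"
    by (intro borel_measurable_integrable integrable_powi_mult integrable_mult_cnj rep_L2_fun)
  have "cinner (Mult (\<lambda>z. z powi (- n)) F) G =
      (LINT z|circle. cnj z powi (- n) * (rep_L2 F (cnj z) * cnj (rep_L2 G (cnj z))))"
    unfolding cinner_Mult_left[OF Linf_fun_powi] by (rule integral_circle_cnj[OF m, symmetric])
  also have "\<dots> = (LINT z|circle. z powi n * (rep_L2 F (cnj z) * cnj (rep_L2 G (cnj z))))"
    by (intro Bochner_Integration.integral_cong refl)
      (simp add: space_circle cnj_powi_circle flip: complex_cnj_power_int)
  finally show ?thesis .
qed

lemma even_part_eqI:
  assumes "integrable circle h" "integrable circle k"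
    and "\<And>n. (LINT z|circle. z powi (2 * n) * h z) = (LINT z|circle. z powi (2 * n) * k z)"
  shows "AE z in circle. h z + h (- z) = k z + k (- z)"
proof -
  have "AE z in circle. even_part (\<lambda>z. h z - k z) z = 0"
    using assms by (intro fourier_null_even_part) (auto simp: right_diff_distrib integrable_powi_mult)
  then show ?thesis
    by eventually_elim (simp add: even_part_def algebra_simps)
qed

lemma integrable_rep: "integrable circle (\<lambda>z. rep_L2 F z * cnj (rep_L2 G z))"
  by (intro integrable_mult_cnj rep_L2_fun)

subsection \<open>Conjugations commuting with \<open>Mult (\<lambda>z. z\<^sup>2)\<close>\<close>

context
  fixes C :: "L2 \<Rightarrow> L2"
  assumes conj: "conjugation C" and commute: "C \<circ> Mult (\<lambda>z. z\<^sup>2) = Mult (\<lambda>z. z\<^sup>2) \<circ> C"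
begin

text \<open>The isometry together with the involution gives \<langle>C u, v\<rangle> = \<langle>C v,
  u\<rangle>. Applied with u = G and v = z^(-2n) F, it puts opposite exponents on the two sides; the
  reflection of one side compensates for this.\<close>

lemma conjugation_symmetry:
  "AE z in circle.
    rep_L2 (C G) z * cnj (rep_L2 F z) + rep_L2 (C G) (- z) * cnj (rep_L2 F (- z)) =
    rep_L2 (C F) (cnj z) * cnj (rep_L2 G (cnj z)) + rep_L2 (C F) (- cnj z) * cnj (rep_L2 G (- cnj z))"
proof -
  have "(LINT z|circle. z powi (2 * n) * (rep_L2 (C G) z * cnj (rep_L2 F z))) =
      (LINT z|circle. z powi (2 * n) * (rep_L2 (C F) (cnj z) * cnj (rep_L2 G (cnj z))))" for n
  proof -
    let ?Z = "\<lambda>n. Mult (\<lambda>z. z powi n)"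
    have CC: "C (C H) = H" for H
      using conj by (simp add: conjugation_def fun_eq_iff)
    have "cinner (?Z (2 * n) (C G)) F = cinner (C G) (?Z (2 * (- n)) F)"
      by (simp add: cinner_Mult_powi_right)
    also have "\<dots> = cinner (C (?Z (2 * (- n)) F)) (C (C G))"
      using conj by (simp add: conjugation_def)
    also have "\<dots> = cinner (?Z (- (2 * n)) (C F)) G"
      using commute_Mult_powi[OF commute, of "- n" F] by (simp add: CC)
    finally show ?thesis
      unfolding cinner_Mult_powi_reflect by (simp add: cinner_Mult_left Linf_fun_powi)
  qed
  from even_part_eqI[OF integrable_rep integrable_circle_cnj[OF integrable_rep] this]
  show ?thesis by simp
qed

text \<open>The power z^(2n) passes through \<open>C\<close>, and the isometry then swaps the
  arguments, so the power lands in the second slot and is conjugated.\<close>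

lemma conjugation_isometry:
  "AE z in circle.
    rep_L2 (C F) z * cnj (rep_L2 (C G) z) + rep_L2 (C F) (- z) * cnj (rep_L2 (C G) (- z)) =
    rep_L2 G (cnj z) * cnj (rep_L2 F (cnj z)) + rep_L2 G (- cnj z) * cnj (rep_L2 F (- cnj z))"
proof -
  have "(LINT z|circle. z powi (2 * n) * (rep_L2 (C F) z * cnj (rep_L2 (C G) z))) =
      (LINT z|circle. z powi (2 * n) * (rep_L2 G (cnj z) * cnj (rep_L2 F (cnj z))))" for n
  proof -
    let ?Z = "\<lambda>n. Mult (\<lambda>z. z powi n)"
    have "cinner (?Z (2 * n) (C F)) (C G) = cinner (C (?Z (2 * n) F)) (C G)"
      by (simp add: commute_Mult_powi[OF commute])
    also have "\<dots> = cinner G (?Z (2 * n) F)"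
      using conj by (simp add: conjugation_def)
    finally show ?thesis
      unfolding cinner_Mult_powi_right cinner_Mult_powi_reflect by (simp add: cinner_Mult_left Linf_fun_powi)
  qed
  from even_part_eqI[OF integrable_rep integrable_circle_cnj[OF integrable_rep] this]
  show ?thesis by simp
qed

end

section \<open>Recovering the symbols from the values of \<open>C\<close> at 1 and z\<close>

lemma L2_fun_one: "(\<lambda>_. 1) \<in> L2_fun"
  by (simp add: L2_fun_def)

lemma L2_fun_ident: "(\<lambda>z. z) \<in> L2_fun"
  using Linf_mult_L2_fun[OF Linf_fun_power[of 1] L2_fun_one] by simp

text \<open>The letters stand for the values of \<open>\<xi>\<^sub>1\<close> and
  \<open>\<xi>\<^sub>2\<close> at z and -z. The hypotheses say that the matrix with columns (a, a')
  and (b, -b') is sqrt 2 times a unitary; hence its rows also have squared norm 2. The second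
  identity is the parallelogram law for a + b and b' - a', whose cross terms cancel.\<close>

lemma unitary_symbol_identities:
  fixes a a' b b' :: complex
  assumes a: "(cmod a)\<^sup>2 + (cmod a')\<^sup>2 = 2" and b: "(cmod b)\<^sup>2 + (cmod b')\<^sup>2 = 2"
    and ab: "b * cnj a = b' * cnj a'"
  shows "(cmod a)\<^sup>2 + (cmod b)\<^sup>2 = 2"
    and "(cmod ((b + b') / 2 + (a - a') / 2))\<^sup>2 + (cmod ((b - b') / 2 + (a + a') / 2))\<^sup>2 = 2"
proof -
  have "(cmod b)\<^sup>2 * (cmod a)\<^sup>2 = (cmod b')\<^sup>2 * (cmod a')\<^sup>2"
    using arg_cong[OF ab, of "\<lambda>x. (cmod x)\<^sup>2"] by (simp add: norm_mult power_mult_distrib)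
  moreover have "(cmod a')\<^sup>2 = 2 - (cmod a)\<^sup>2" "(cmod b')\<^sup>2 = 2 - (cmod b)\<^sup>2"
    using a b by simp_all
  \<comment> \<open>After expansion the products cancel, and a linear relation between the squared
    moduli remains.\<close>
  ultimately have "(cmod b)\<^sup>2 * (cmod a)\<^sup>2 = (2 - (cmod b)\<^sup>2) * (2 - (cmod a)\<^sup>2)"
    by (simp only:)
  then show "(cmod a)\<^sup>2 + (cmod b)\<^sup>2 = 2"
    by (simp add: algebra_simps)
  have "Re (b * cnj a) = Re (b' * cnj a')"
    using ab by simp
  then show "(cmod ((b + b') / 2 + (a - a') / 2))\<^sup>2 + (cmod ((b - b') / 2 + (a + a') / 2))\<^sup>2 = 2"
    using a b unfolding cmod_power2 by (simp add: power2_eq_square field_simps)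
qed

theorem corollary4p7:
  fixes C :: "L2 \<Rightarrow> L2"
  assumes "conjugation C"
  shows "(C \<circ> Mult (\<lambda>z. z\<^sup>2) = Mult (\<lambda>z. z\<^sup>2) \<circ> C \<longrightarrow>
           (\<exists>\<xi>\<^sub>1\<in>Linf_fun. \<exists>\<xi>\<^sub>2\<in>Linf_fun.
              C = Mult_eo \<xi>\<^sub>1 \<xi>\<^sub>2 \<circ> Jstar \<and>
              (AE z in circle.
                 (cmod (\<xi>\<^sub>1 z))\<^sup>2 + (cmod (\<xi>\<^sub>2 z))\<^sup>2 = 2 \<and>
                 (cmod (even_part \<xi>\<^sub>2 z + odd_part \<xi>\<^sub>1 z))\<^sup>2 +
                   (cmod (odd_part \<xi>\<^sub>2 z + even_part \<xi>\<^sub>1 z))\<^sup>2 = 2 \<and>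
                 odd_part \<xi>\<^sub>1 (cnj z) = odd_part \<xi>\<^sub>2 z \<and>
                 even_part \<xi>\<^sub>1 (cnj z) = even_part \<xi>\<^sub>1 z \<and>
                 even_part \<xi>\<^sub>2 (cnj z) = even_part \<xi>\<^sub>2 z))) \<and>
         (\<forall>\<xi>\<^sub>1\<in>Linf_fun. \<forall>\<xi>\<^sub>2\<in>Linf_fun.
            C = Mult_eo \<xi>\<^sub>1 \<xi>\<^sub>2 \<circ> Jstar \<longrightarrow>
            C \<circ> Mult (\<lambda>z. z\<^sup>2) = Mult (\<lambda>z. z\<^sup>2) \<circ> C)"
proof (intro conjI impI ballI)
  assume commute: "C \<circ> Mult (\<lambda>z. z\<^sup>2) = Mult (\<lambda>z. z\<^sup>2) \<circ> C"
  define I Z where "I = abs_L2 (\<lambda>_. 1)" and "Z = abs_L2 (\<lambda>z. z)"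
  \<comment> \<open>\<open>Jstar\<close> fixes the even function 1 and the odd function z, so the
    desired formula forces C 1 = \<open>\<xi>\<^sub>1\<close> and C z = z
    \<open>\<xi>\<^sub>2\<close>. On the circle, \<open>cnj z\<close> performs the division by
    z.\<close>
  define \<xi>\<^sub>1 \<xi>\<^sub>2 where "\<xi>\<^sub>1 = rep_L2 (C I)" and "\<xi>\<^sub>2 z = cnj z * rep_L2 (C Z) z" for z
  have unit: "AE z in circle. z * cnj z = 1"
    by (rule AE_circleI) (simp add: complex_norm_square[symmetric])
  have I: "AE z in circle. rep_L2 I z = 1"
    unfolding I_def using L2_fun_one by (rule rep_abs_L2)
  have Z: "AE z in circle. rep_L2 Z z = z"
    unfolding Z_def using L2_fun_ident by (rule rep_abs_L2)
  have CZ: "AE z in circle. rep_L2 (C Z) z = z * \<xi>\<^sub>2 z"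
    using unit by eventually_elim (simp add: \<xi>\<^sub>2_def flip: mult.assoc)
  note flip = AE_circle_uminus AE_circle_cnj AE_circle_uminus[OF AE_circle_cnj]

  \<comment> \<open>The symmetry with G = 1, read at \<open>cnj z\<close>, gives twice the even part
    of \<open>C F\<close>.\<close>
  have even: "AE z in circle. rep_L2 (C F) z + rep_L2 (C F) (- z) =
      \<xi>\<^sub>1 (cnj z) * cnj (rep_L2 F (cnj z)) + \<xi>\<^sub>1 (- cnj z) * cnj (rep_L2 F (- cnj z))" for F
    using AE_circle_cnj[OF conjugation_symmetry[OF assms commute, of I F]] I flip(1)[OF I]
    by eventually_elim (simp add: \<xi>\<^sub>1_def)
  \<comment> \<open>With G = z the second term changes sign, which gives twice the odd part of
    \<open>C F\<close> up to the nonzero factor \<open>cnj z\<close>.\<close>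
  have odd: "AE z in circle. rep_L2 (C F) z - rep_L2 (C F) (- z) =
      \<xi>\<^sub>2 (cnj z) * cnj (rep_L2 F (cnj z)) - \<xi>\<^sub>2 (- cnj z) * cnj (rep_L2 F (- cnj z))" for F
    using AE_circle_cnj[OF conjugation_symmetry[OF assms commute, of Z F]] Z flip(1)[OF Z]
      flip(2)[OF CZ] flip(2)[OF flip(1)[OF CZ]] unit
  proof eventually_elim
    case (elim z)
    have "cnj z * (rep_L2 (C F) z - rep_L2 (C F) (- z)) =
      cnj z * (\<xi>\<^sub>2 (cnj z) * cnj (rep_L2 F (cnj z)) - \<xi>\<^sub>2 (- cnj z) * cnj (rep_L2 F (- cnj z)))"
      using elim(1-5) by (simp add: algebra_simps)
    moreover have "cnj z \<noteq> 0"
      using elim(6) by auto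
    ultimately show ?case by simp
  qed

  \<comment> \<open>The four relations come from the two formulas above at F = 1 and F = z; at F = z
    a common factor z is cancelled.\<close>
  have symm: "AE z in circle. \<xi>\<^sub>1 (cnj z) + \<xi>\<^sub>1 (- cnj z) = \<xi>\<^sub>1 z + \<xi>\<^sub>1 (- z) \<and>
      \<xi>\<^sub>2 (cnj z) - \<xi>\<^sub>2 (- cnj z) = \<xi>\<^sub>1 z - \<xi>\<^sub>1 (- z) \<and>
      \<xi>\<^sub>1 (cnj z) - \<xi>\<^sub>1 (- cnj z) = \<xi>\<^sub>2 z - \<xi>\<^sub>2 (- z) \<and>
      \<xi>\<^sub>2 (cnj z) + \<xi>\<^sub>2 (- cnj z) = \<xi>\<^sub>2 z + \<xi>\<^sub>2 (- z)"
    using even[of I] odd[of I] even[of Z] odd[of Z] flip(2)[OF I] flip(2)[OF flip(1)[OF I]]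
      flip(2)[OF Z] flip(2)[OF flip(1)[OF Z]] CZ flip(1)[OF CZ] unit
  proof eventually_elim
    case (elim z)
    have z: "z \<noteq> 0"
      using elim(11) by auto
    have "z * (\<xi>\<^sub>1 (cnj z) - \<xi>\<^sub>1 (- cnj z)) = z * (\<xi>\<^sub>2 z - \<xi>\<^sub>2 (- z))"
      "z * (\<xi>\<^sub>2 (cnj z) + \<xi>\<^sub>2 (- cnj z)) = z * (\<xi>\<^sub>2 z + \<xi>\<^sub>2 (- z))"
      using elim(3,4,7-10) by (simp_all add: algebra_simps)
    then show ?case
      using z elim(1,2,5,6) by (simp add: \<xi>\<^sub>1_def)
  qed

  \<comment> \<open>The pairs (1, 1) and (z, z) give the two norm conditions. In the mixed pair the
    contributions of z and -z to the right-hand side cancel, which gives the orthogonality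
    condition.\<close>
  have moduli: "AE z in circle. (cmod (\<xi>\<^sub>1 z))\<^sup>2 + (cmod (\<xi>\<^sub>2 z))\<^sup>2 = 2 \<and>
      (cmod (even_part \<xi>\<^sub>2 z + odd_part \<xi>\<^sub>1 z))\<^sup>2 + (cmod (odd_part \<xi>\<^sub>2 z + even_part \<xi>\<^sub>1 z))\<^sup>2 = 2"
    using conjugation_isometry[OF assms commute, of I I] conjugation_isometry[OF assms commute, of Z Z]
      conjugation_isometry[OF assms commute, of Z I] flip(2)[OF I] flip(2)[OF flip(1)[OF I]]
      flip(2)[OF Z] flip(2)[OF flip(1)[OF Z]] CZ flip(1)[OF CZ] unit
  proof eventually_elim
    case (elim z)
    have z: "z \<noteq> 0" "cnj z * z = 1"
      using elim(10) by (auto simp: mult.commute)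
    have "\<xi>\<^sub>1 z * cnj (\<xi>\<^sub>1 z) + \<xi>\<^sub>1 (- z) * cnj (\<xi>\<^sub>1 (- z)) = 2"
      using elim(1,4,5) by (simp add: \<xi>\<^sub>1_def)
    then have 1: "(cmod (\<xi>\<^sub>1 z))\<^sup>2 + (cmod (\<xi>\<^sub>1 (- z)))\<^sup>2 = 2"
      unfolding complex_norm_square[symmetric]
      by (metis (mono_tags, lifting) of_real_add of_real_eq_iff of_real_numeral)
    have "(z * cnj z) * (\<xi>\<^sub>2 z * cnj (\<xi>\<^sub>2 z) + \<xi>\<^sub>2 (- z) * cnj (\<xi>\<^sub>2 (- z))) = 2 * (cnj z * z)"
      using elim(2,6-9) by (simp add: algebra_simps)
    then have "\<xi>\<^sub>2 z * cnj (\<xi>\<^sub>2 z) + \<xi>\<^sub>2 (- z) * cnj (\<xi>\<^sub>2 (- z)) = 2"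
      by (simp add: elim(10) z)
    then have 2: "(cmod (\<xi>\<^sub>2 z))\<^sup>2 + (cmod (\<xi>\<^sub>2 (- z)))\<^sup>2 = 2"
      unfolding complex_norm_square[symmetric]
      by (metis (mono_tags, lifting) of_real_add of_real_eq_iff of_real_numeral)
    have "z * (\<xi>\<^sub>2 z * cnj (\<xi>\<^sub>1 z)) = z * (\<xi>\<^sub>2 (- z) * cnj (\<xi>\<^sub>1 (- z)))"
      using elim(3,4-9) by (simp add: \<xi>\<^sub>1_def algebra_simps)
    then have 3: "\<xi>\<^sub>2 z * cnj (\<xi>\<^sub>1 z) = \<xi>\<^sub>2 (- z) * cnj (\<xi>\<^sub>1 (- z))"
      using z by simp
    show ?case
      using unitary_symbol_identities[OF 1 2 3] by (simp add: even_part_def odd_part_def)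
  qed

  have m1: "\<xi>\<^sub>1 \<in> borel_measurable circle" and "rep_L2 (C Z) \<in> borel_measurable circle"
    using rep_L2_fun unfolding L2_fun_def \<xi>\<^sub>1_def by auto
  then have m2: "\<xi>\<^sub>2 \<in> borel_measurable circle"
    unfolding \<xi>\<^sub>2_def using measurable_circleI[OF borel_measurable_cnj] by simp
  \<comment> \<open>A priori the symbols are only square integrable. The first modulus identity
    bounds both by sqrt 2, and 2 is a convenient larger bound.\<close>
  have bound: "x \<le> 2" if "x\<^sup>2 + y\<^sup>2 = 2" for x y :: real
  proof (rule power2_le_imp_le)
    have "x\<^sup>2 \<le> 4"
      using that zero_le_power2[of y] by linarith
    then show "x\<^sup>2 \<le> 2\<^sup>2"
      by simp
  qed simp
  have "AE z in circle. cmod (\<xi>\<^sub>1 z) \<le> 2" "AE z in circle. cmod (\<xi>\<^sub>2 z) \<le> 2"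
    using moduli by (eventually_elim, metis bound add.commute)+
  then have inf: "\<xi>\<^sub>1 \<in> Linf_fun" "\<xi>\<^sub>2 \<in> Linf_fun"
    using m1 m2 by (auto simp: Linf_fun_def)

  have "C F = Mult_eo \<xi>\<^sub>1 \<xi>\<^sub>2 (Jstar F)" for F
  proof (rule L2_eqI)
    show "AE z in circle. rep_L2 (C F) z = rep_L2 (Mult_eo \<xi>\<^sub>1 \<xi>\<^sub>2 (Jstar F)) z"
      using rep_Mult_eo_Jstar[OF inf, of F] even[of F] odd[of F] symm
    proof eventually_elim
      case (elim z)
      define k k' where "k = cnj (rep_L2 F (cnj z))" and "k' = cnj (rep_L2 F (- cnj z))"
      \<comment> \<open>Even and odd parts are reassembled: each reflected symbol value is the sum
        or difference of an even and an odd part, rewritten at z by \<open>symm\<close>.\<close>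
      have s: "2 * \<xi>\<^sub>1 (cnj z) = \<xi>\<^sub>1 z + \<xi>\<^sub>1 (- z) + \<xi>\<^sub>2 z - \<xi>\<^sub>2 (- z)"
        "2 * \<xi>\<^sub>1 (- cnj z) = \<xi>\<^sub>1 z + \<xi>\<^sub>1 (- z) - \<xi>\<^sub>2 z + \<xi>\<^sub>2 (- z)"
        "2 * \<xi>\<^sub>2 (cnj z) = \<xi>\<^sub>2 z + \<xi>\<^sub>2 (- z) + \<xi>\<^sub>1 z - \<xi>\<^sub>1 (- z)"
        "2 * \<xi>\<^sub>2 (- cnj z) = \<xi>\<^sub>2 z + \<xi>\<^sub>2 (- z) - \<xi>\<^sub>1 z + \<xi>\<^sub>1 (- z)"
        using elim(4) by algebra+
      have "rep_L2 (C F) z + rep_L2 (C F) (- z) = \<xi>\<^sub>1 (cnj z) * k + \<xi>\<^sub>1 (- cnj z) * k'"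
        "rep_L2 (C F) z - rep_L2 (C F) (- z) = \<xi>\<^sub>2 (cnj z) * k - \<xi>\<^sub>2 (- cnj z) * k'"
        using elim(2,3) by (simp_all add: k_def k'_def)
      \<comment> \<open>Adding the two equations, the coefficient of \<open>k\<close> becomes
        \<open>\<xi>\<^sub>1 z + \<xi>\<^sub>2 z\<close> and that of \<open>k'\<close> becomes
        \<open>\<xi>\<^sub>1 z - \<xi>\<^sub>2 z\<close>.\<close>
      then have "2 * rep_L2 (C F) z = \<xi>\<^sub>1 z * (k + k') + \<xi>\<^sub>2 z * (k - k')"
        using s by algebra
      also have "\<dots> = 2 * rep_L2 (Mult_eo \<xi>\<^sub>1 \<xi>\<^sub>2 (Jstar F)) z"
        unfolding elim(1)[folded k_def k'_def] by (simp add: field_simps)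
      finally show ?case
        by simp
    qed
  qed
  then have "C = Mult_eo \<xi>\<^sub>1 \<xi>\<^sub>2 \<circ> Jstar"
    by (simp add: fun_eq_iff)
  moreover have "AE z in circle.
      odd_part \<xi>\<^sub>1 (cnj z) = odd_part \<xi>\<^sub>2 z \<and>
      even_part \<xi>\<^sub>1 (cnj z) = even_part \<xi>\<^sub>1 z \<and>
      even_part \<xi>\<^sub>2 (cnj z) = even_part \<xi>\<^sub>2 z"
    using symm by eventually_elim (simp add: even_part_def odd_part_def)
  ultimately show "\<exists>\<xi>\<^sub>1\<in>Linf_fun. \<exists>\<xi>\<^sub>2\<in>Linf_fun.
      C = Mult_eo \<xi>\<^sub>1 \<xi>\<^sub>2 \<circ> Jstar \<and>
      (AE z in circle.
         (cmod (\<xi>\<^sub>1 z))\<^sup>2 + (cmod (\<xi>\<^sub>2 z))\<^sup>2 = 2 \<and>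
         (cmod (even_part \<xi>\<^sub>2 z + odd_part \<xi>\<^sub>1 z))\<^sup>2 +
           (cmod (odd_part \<xi>\<^sub>2 z + even_part \<xi>\<^sub>1 z))\<^sup>2 = 2 \<and>
         odd_part \<xi>\<^sub>1 (cnj z) = odd_part \<xi>\<^sub>2 z \<and>
         even_part \<xi>\<^sub>1 (cnj z) = even_part \<xi>\<^sub>1 z \<and>
         even_part \<xi>\<^sub>2 (cnj z) = even_part \<xi>\<^sub>2 z)"
    using inf moduli by (intro bexI[of _ \<xi>\<^sub>1] bexI[of _ \<xi>\<^sub>2]) auto
next
  fix \<xi>\<^sub>1 \<xi>\<^sub>2
  assume xi: "\<xi>\<^sub>1 \<in> Linf_fun" "\<xi>\<^sub>2 \<in> Linf_fun" and C: "C = Mult_eo \<xi>\<^sub>1 \<xi>\<^sub>2 \<circ> Jstar"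
  let ?M = "Mult (\<lambda>z. z\<^sup>2)"
  \<comment> \<open>The factor z^2 is unchanged by \<open>Jstar\<close>, as conjugating both
    argument and value restores it, and being even it passes through the even and odd parts.\<close>
  have "C (?M F) = ?M (C F)" for F
  proof (rule L2_eqI)
    note MF = rep_Mult[OF Linf_fun_power, of 2 F]
    show "AE z in circle. rep_L2 (C (?M F)) z = rep_L2 (?M (C F)) z"
      unfolding C o_apply
      using rep_Mult_eo_Jstar[OF xi, of "?M F"] rep_Mult_eo_Jstar[OF xi, of F]
        rep_Mult[OF Linf_fun_power, of 2 "Mult_eo \<xi>\<^sub>1 \<xi>\<^sub>2 (Jstar F)"]
        AE_circle_cnj[OF MF] AE_circle_cnj[OF AE_circle_uminus[OF MF]]
    proof eventually_elim
      case (elim z)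
      show ?case
        by (simp only: elim complex_cnj_mult complex_cnj_power complex_cnj_cnj complex_cnj_minus power2_minus)
          (simp add: algebra_simps add_divide_distrib diff_divide_distrib)
    qed
  qed
  then show "C \<circ> ?M = ?M \<circ> C"
    by (simp add: fun_eq_iff)
qed

end
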